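(* For $k\ge 1$, let $A_k$ denote the number of associative quasitrivial nondecreasing binary operations $F:L_k^2\to L_k$, and let $B_k$ denote the number of associative quasitrivial nondecreasing binary operations $F:L_k^2\to L_k$ having a neutral element. Then $$A_k=\frac{1}{6}\Big((2+\sqrt{3})(1+\sqrt{3})^k+(2-\sqrt{3})(1-\sqrt{3})^k-4\Big),$$ $$B_k=\frac{1}{2\sqrt{3}}\Big((1+\sqrt{3})^k-(1-\sqrt{3})^k\Big).$$
   Context: $L_k=\{1,\dots,k\}$ with the natural order. An operation $F:L_k^2\to L_k$ is quasitrivial if $F(x,y)\in\{x,y\}$ for all $x,y$; associative if $F(F(x,y),z)=F(x,F(y,z))$ for all $x,y,z$; nondecreasing if $F(x,y)\le F(x',y')$ whenever $x\le x'$ and $y\le y'$. An element $e$ is a neutral element of $F$ if $F(e,x)=F(x,e)=x$ for all $x\in L_k$. *)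

theory Defs
  imports Complex_Main "HOL-Library.FuncSet"
begin

definition chain :: "nat \<Rightarrow> nat set" where
  "chain k = {1..k}"

text \<open>Binary operations on a set are extensional functions (undefined outside
  \<open>X \<times> X\<close>), so that distinct HOL functions are distinct operations on \<open>X\<close> and
  counting them with \<^const>\<open>card\<close> is meaningful.\<close>

definition binary_operations :: "'a set \<Rightarrow> ('a \<times> 'a \<Rightarrow> 'a) set" where
  "binary_operations X = (X \<times> X) \<rightarrow>\<^sub>E X"

definition quasitrivial_on :: "'a set \<Rightarrow> ('a \<times> 'a \<Rightarrow> 'a) \<Rightarrow> bool" where
  "quasitrivial_on X F \<longleftrightarrow> (\<forall>x\<in>X. \<forall>y\<in>X. F (x, y) \<in> {x, y})"

definition associative_on :: "'a set \<Rightarrow> ('a \<times> 'a \<Rightarrow> 'a) \<Rightarrow> bool" where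
  "associative_on X F \<longleftrightarrow>
     (\<forall>x\<in>X. \<forall>y\<in>X. \<forall>z\<in>X. F (F (x, y), z) = F (x, F (y, z)))"

definition nondecreasing_on :: "'a::order set \<Rightarrow> ('a \<times> 'a \<Rightarrow> 'a) \<Rightarrow> bool" where
  "nondecreasing_on X F \<longleftrightarrow>
     (\<forall>x\<in>X. \<forall>x'\<in>X. \<forall>y\<in>X. \<forall>y'\<in>X. x \<le> x' \<longrightarrow> y \<le> y' \<longrightarrow> F (x, y) \<le> F (x', y'))"

definition neutral_element_on :: "'a set \<Rightarrow> ('a \<times> 'a \<Rightarrow> 'a) \<Rightarrow> 'a \<Rightarrow> bool" where
  "neutral_element_on X F e \<longleftrightarrow> e \<in> X \<and> (\<forall>x\<in>X. F (e, x) = x \<and> F (x, e) = x)"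

definition aqn_operations :: "nat \<Rightarrow> (nat \<times> nat \<Rightarrow> nat) set" where
  "aqn_operations k = {F \<in> binary_operations (chain k).
     associative_on (chain k) F \<and> quasitrivial_on (chain k) F \<and> nondecreasing_on (chain k) F}"

definition A_num :: "nat \<Rightarrow> nat" where
  "A_num k = card (aqn_operations k)"

definition B_num :: "nat \<Rightarrow> nat" where
  "B_num k = card {F \<in> aqn_operations k. \<exists>e. neutral_element_on (chain k) F e}"

end

theory Submission
  imports Defs
begin

text \<open>Let \<open>a < b\<close> be the extreme elements of a finite chain with \<open>n\<close> elements. By monotonicity, if
  \<open>F(a,b) = F(b,a)\<close> then this value is an annihilator, and removing it leaves an arbitrary operation
  on \<open>n - 1\<close> points. If \<open>F(a,b) = a\<close> and \<open>F(b,a) = b\<close>, then either \<open>F\<close> is the first projection,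
  or \<open>{a,b}\<close> is an ideal of left zeros whose removal leaves an arbitrary operation on \<open>n - 2\<close> points;
  the remaining case is the mirror image. Hence \<open>A\<^sub>n = 2 A\<^sub>n\<^sub>-\<^sub>1 + 2 A\<^sub>n\<^sub>-\<^sub>2 + 2\<close>. Removal preserves the
  existence of a neutral element, and a projection has none, so \<open>B\<^sub>n = 2 B\<^sub>n\<^sub>-\<^sub>1 + 2 B\<^sub>n\<^sub>-\<^sub>2\<close>.\<close>

section \<open>Operations on arbitrary chains\<close>

text \<open>Stated for arbitrary sets, since deleting least elements leaves the family
  \<open>chain k\<close>.\<close>

definition aqn_on :: "'a::linorder set \<Rightarrow> ('a \<times> 'a \<Rightarrow> 'a) set" where
  "aqn_on X = {F \<in> binary_operations X.
     associative_on X F \<and> quasitrivial_on X F \<and> nondecreasing_on X F}"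

definition has_neutral :: "'a set \<Rightarrow> ('a \<times> 'a \<Rightarrow> 'a) \<Rightarrow> bool" where
  "has_neutral X F \<longleftrightarrow> (\<exists>e. neutral_element_on X F e)"

text \<open>For a singleton \<open>Z\<close> this is an annihilator, so one removal argument serves
  both \<open>{a}\<close> and \<open>{a, b}\<close>.\<close>

definition left_zero_ideal :: "'a set \<Rightarrow> 'a set \<Rightarrow> ('a \<times> 'a \<Rightarrow> 'a) \<Rightarrow> bool" where
  "left_zero_ideal X Z F \<longleftrightarrow>
     (\<forall>z\<in>Z. \<forall>x\<in>X. F (z, x) = z \<and> (x \<notin> Z \<longrightarrow> F (x, z) = z))"

text \<open>Inverse of restriction to \<open>X - Z\<close>; testing \<open>x\<close> first makes the
  elements of \<open>Z\<close> left zeros among themselves.\<close>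

definition extend_left_zero :: "'a set \<Rightarrow> 'a set \<Rightarrow> ('a \<times> 'a \<Rightarrow> 'a) \<Rightarrow> 'a \<times> 'a \<Rightarrow> 'a" where
  "extend_left_zero X Z F = (\<lambda>(x, y)\<in>X \<times> X. if x \<in> Z then x else if y \<in> Z then y else F (x, y))"

definition flip :: "'a set \<Rightarrow> ('a \<times> 'a \<Rightarrow> 'a) \<Rightarrow> 'a \<times> 'a \<Rightarrow> 'a" where
  "flip X F = (\<lambda>(x, y)\<in>X \<times> X. F (y, x))"

lemma aqn_onD:
  assumes "F \<in> aqn_on X"
  shows "x \<in> X \<Longrightarrow> y \<in> X \<Longrightarrow> F (x, y) \<in> X"
    and "x \<in> X \<Longrightarrow> y \<in> X \<Longrightarrow> F (x, y) = x \<or> F (x, y) = y"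
    and "x \<in> X \<Longrightarrow> y \<in> X \<Longrightarrow> z \<in> X \<Longrightarrow> F (F (x, y), z) = F (x, F (y, z))"
    and "\<lbrakk>x \<in> X; x' \<in> X; y \<in> X; y' \<in> X; x \<le> x'; y \<le> y'\<rbrakk> \<Longrightarrow> F (x, y) \<le> F (x', y')"
    and "F \<in> extensional (X \<times> X)"
  using assms
  by (auto simp: aqn_on_def binary_operations_def quasitrivial_on_def associative_on_def
      nondecreasing_on_def PiE_def)

lemma aqn_onI:
  assumes "F \<in> extensional (X \<times> X)"
    and "\<And>x y. x \<in> X \<Longrightarrow> y \<in> X \<Longrightarrow> F (x, y) = x \<or> F (x, y) = y"
    and "\<And>x y z. x \<in> X \<Longrightarrow> y \<in> X \<Longrightarrow> z \<in> X \<Longrightarrow> F (F (x, y), z) = F (x, F (y, z))"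
    and "\<And>x x' y y'. \<lbrakk>x \<in> X; x' \<in> X; y \<in> X; y' \<in> X; x \<le> x'; y \<le> y'\<rbrakk>
      \<Longrightarrow> F (x, y) \<le> F (x', y')"
  shows "F \<in> aqn_on X"
proof -
  have "F (x, y) \<in> X" if "x \<in> X" "y \<in> X" for x y
    using assms(2)[OF that] that by auto
  then show ?thesis
    using assms by (auto simp: aqn_on_def binary_operations_def quasitrivial_on_def
        associative_on_def nondecreasing_on_def PiE_def)
qed

lemma finite_aqn_on:
  assumes "finite X"
  shows "finite (aqn_on X)"
proof -
  have "finite (binary_operations X)"
    unfolding binary_operations_def by (rule finite_PiE) (use assms in auto)
  then show ?thesis
    by (rule rev_finite_subset) (auto simp: aqn_on_def)
qed

lemma restrict_aqn_on:
  assumes "F \<in> aqn_on X" "Y \<subseteq> X"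
  shows "restrict F (Y \<times> Y) \<in> aqn_on Y"
proof (rule aqn_onI)
  have in_Y: "F (x, y) \<in> Y" if "x \<in> Y" "y \<in> Y" for x y
    using aqn_onD(2)[OF assms(1), of x y] that assms(2) by (metis subsetD)
  show "restrict F (Y \<times> Y) (restrict F (Y \<times> Y) (x, y), z)
      = restrict F (Y \<times> Y) (x, restrict F (Y \<times> Y) (y, z))"
    if "x \<in> Y" "y \<in> Y" "z \<in> Y" for x y z
    using that assms(2) in_Y aqn_onD(3)[OF assms(1), of x y z] by (simp add: subset_iff)
qed (use assms aqn_onD[OF assms(1)] in \<open>simp_all add: subset_iff\<close>)

section \<open>Adjoining and removing a left zero ideal\<close>

text \<open>A product with factors in \<open>Z\<close> equals the leftmost of them, which settles
  associativity. That each element of \<open>Z\<close> is least or greatest in \<open>X\<close>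
  keeps the operation nondecreasing.\<close>

lemma extend_left_zero_aqn_on:
  fixes X :: "'a::linorder set"
  assumes F: "F \<in> aqn_on (X - Z)"
    and Z: "Z \<subseteq> X" "\<And>z. z \<in> Z \<Longrightarrow> (\<forall>x\<in>X. z \<le> x) \<or> (\<forall>x\<in>X. x \<le> z)"
  shows "extend_left_zero X Z F \<in> aqn_on X"
proof (rule aqn_onI)
  let ?G = "extend_left_zero X Z F"
  note D = aqn_onD[OF F]
  have G: "?G (x, y) = (if x \<in> Z then x else if y \<in> Z then y else F (x, y))"
    if "x \<in> X" "y \<in> X" for x y
    using that by (simp add: extend_left_zero_def)
  have FX: "F (x, y) \<in> X" "F (x, y) \<notin> Z" if "x \<in> X" "y \<in> X" "x \<notin> Z" "y \<notin> Z" for x y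
    using D(1)[of x y] that by auto
  show "?G \<in> extensional (X \<times> X)"
    by (simp add: extend_left_zero_def)
  show "?G (x, y) = x \<or> ?G (x, y) = y" if "x \<in> X" "y \<in> X" for x y
    using that D(2)[of x y] by (auto simp: G)
  show "?G (?G (x, y), z) = ?G (x, ?G (y, z))" if "x \<in> X" "y \<in> X" "z \<in> X" for x y z
    using that D(3)[of x y z] FX by (simp add: G)
  show "?G (x, y) \<le> ?G (x', y')"
    if xs: "x \<in> X" "x' \<in> X" "y \<in> X" "y' \<in> X" "x \<le> x'" "y \<le> y'" for x x' y y'
  proof -
    have in_X: "?G (x, y) \<in> X" "?G (x', y') \<in> X"
      using xs FX by (auto simp: G)
    consider "x \<in> Z" | "x \<notin> Z" "y \<in> Z" | "x \<notin> Z" "y \<notin> Z" by blast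
    then show ?thesis
    proof cases
      case 1
      have "?G (x, y) \<le> ?G (x', y')" if "\<forall>v\<in>X. v \<le> x"
      proof -
        have "x' = x" using that xs by (auto intro: antisym)
        then show ?thesis using 1 xs by (simp add: G)
      qed
      then show ?thesis using Z(2)[OF 1] in_X 1 xs by (auto simp: G)
    next
      case 2
      have "?G (x, y) \<le> ?G (x', y')" if v: "\<forall>v\<in>X. v \<le> y"
      proof -
        have y': "y' = y" using v xs by (auto intro: antisym)
        \<comment> \<open>Here \<open>x'\<close> is tested first. Were it least, \<open>x\<close>
          would equal \<open>x'\<close> and lie in \<open>Z\<close>; so it is greatest.\<close>
        have "y \<le> x'" if "x' \<in> Z"
          using Z(2)[OF that]
        proof
          assume "\<forall>v\<in>X. x' \<le> v"
          then have "x' = x" using xs by (auto intro: antisym)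
          then show ?thesis using 2 that by simp
        qed (use xs in auto)
        then show ?thesis using 2 y' xs by (simp add: G)
      qed
      then show ?thesis using Z(2)[OF 2(2)] in_X 2 xs by (auto simp: G)
    next
      case 3
      \<comment> \<open>A value \<open>z\<close> in \<open>Z\<close> must be greatest: a least one
        would force \<open>x\<close> or \<open>y\<close> to equal it and so lie in
        \<open>Z\<close>.\<close>
      have hi: "?thesis" if z: "z = x' \<or> z = y'" "z \<in> Z" and eq: "?G (x', y') = z" for z
        using Z(2)[OF z(2)]
      proof
        assume "\<forall>v\<in>X. z \<le> v"
        then have "z = x \<or> z = y" using z(1) xs by (auto intro: antisym)
        then show ?thesis using z(2) 3 by auto
      qed (use in_X eq in auto)
      show ?thesis
      proof (cases "x' \<in> Z \<or> y' \<in> Z")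
        case True
        then show ?thesis using hi xs by (auto simp: G split: if_splits)
      next
        case False
        then show ?thesis using 3 xs D(4)[of x x' y y'] by (simp add: G)
      qed
    qed
  qed
qed

lemma left_zero_ideal_extend:
  "Z \<subseteq> X \<Longrightarrow> left_zero_ideal X Z (extend_left_zero X Z F)"
  by (auto simp: left_zero_ideal_def extend_left_zero_def)

lemma restrict_extend_left_zero:
  assumes "F \<in> aqn_on (X - Z)"
  shows "restrict (extend_left_zero X Z F) ((X - Z) \<times> (X - Z)) = F"
  using aqn_onD(5)[OF assms]
  by (auto simp: fun_eq_iff extend_left_zero_def restrict_def extensional_def)

lemma extend_restrict_left_zero:
  assumes "F \<in> aqn_on X" "left_zero_ideal X Z F"
  shows "extend_left_zero X Z (restrict F ((X - Z) \<times> (X - Z))) = F"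
  using aqn_onD(5)[OF assms(1)] assms(2)
  by (auto simp: fun_eq_iff extend_left_zero_def restrict_def extensional_def left_zero_ideal_def)

text \<open>A neutral \<open>e\<close> in \<open>Z\<close> would give
  \<open>x = F (e, x) = e\<close> for all \<open>x\<close>, impossible with two elements.
  Conversely, elements of \<open>Z\<close> absorb on both sides, so an element neutral on
  \<open>X - Z\<close> is neutral for them too.\<close>

lemma has_neutral_restrict:
  assumes Z: "Z \<subseteq> X" and X: "card X \<ge> 2" and F: "left_zero_ideal X Z F"
  shows "has_neutral (X - Z) (restrict F ((X - Z) \<times> (X - Z))) \<longleftrightarrow> has_neutral X F"
proof -
  have "e \<notin> Z" if e: "neutral_element_on X F e" for e
  proof
    assume "e \<in> Z"
    then have "x = e" if "x \<in> X" for x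
      using e F that by (auto simp: neutral_element_on_def left_zero_ideal_def)
    then have "X \<subseteq> {e}" by auto
    then have "card X \<le> 1" using card_mono[of "{e}" X] by simp
    then show False using X by simp
  qed
  then have "neutral_element_on (X - Z) (restrict F ((X - Z) \<times> (X - Z))) e"
    if "neutral_element_on X F e" for e
    using that by (auto simp: neutral_element_on_def)
  moreover have "neutral_element_on X F e"
    if e: "neutral_element_on (X - Z) (restrict F ((X - Z) \<times> (X - Z))) e" for e
    unfolding neutral_element_on_def
  proof (intro conjI ballI)
    show "e \<in> X" using e by (simp add: neutral_element_on_def)
    show "F (e, x) = x" "F (x, e) = x" if "x \<in> X" for x
      using e F that by (cases "x \<in> Z"; simp add: neutral_element_on_def left_zero_ideal_def)+
  qed
  ultimately show ?thesis unfolding has_neutral_def by blast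
qed

text \<open>Restriction and \<open>extend_left_zero\<close> are mutually inverse, and by
  \<open>has_neutral_restrict\<close> they respect the existence of a neutral element.\<close>

lemma card_left_zero_ideal:
  fixes X :: "'a::linorder set"
  assumes Z: "Z \<subseteq> X" "\<And>z. z \<in> Z \<Longrightarrow> (\<forall>x\<in>X. z \<le> x) \<or> (\<forall>x\<in>X. x \<le> z)"
    and X: "card X \<ge> 2"
  shows "card {F \<in> aqn_on X. left_zero_ideal X Z F} = card (aqn_on (X - Z))"
    and "card {F \<in> aqn_on X. left_zero_ideal X Z F \<and> has_neutral X F}
      = card {F \<in> aqn_on (X - Z). has_neutral (X - Z) F}"
proof -
  let ?r = "\<lambda>F. restrict F ((X - Z) \<times> (X - Z))"
  have extend: "extend_left_zero X Z F \<in> aqn_on X" if "F \<in> aqn_on (X - Z)" for F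
    using that Z by (rule extend_left_zero_aqn_on)
  note facts = extend restrict_aqn_on[OF _ Diff_subset] left_zero_ideal_extend[OF Z(1)]
    restrict_extend_left_zero extend_restrict_left_zero
  have "bij_betw ?r {F \<in> aqn_on X. left_zero_ideal X Z F} (aqn_on (X - Z))"
    by (rule bij_betw_byWitness[where f' = "extend_left_zero X Z"])
      (auto simp: facts)
  then show "card {F \<in> aqn_on X. left_zero_ideal X Z F} = card (aqn_on (X - Z))"
    by (rule bij_betw_same_card)
  have "has_neutral X (extend_left_zero X Z F)"
    if "F \<in> aqn_on (X - Z)" "has_neutral (X - Z) F" for F
    using has_neutral_restrict[OF Z(1) X left_zero_ideal_extend[OF Z(1), of F]] that
    by (simp add: restrict_extend_left_zero)
  then have "bij_betw ?r {F \<in> aqn_on X. left_zero_ideal X Z F \<and> has_neutral X F}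
      {F \<in> aqn_on (X - Z). has_neutral (X - Z) F}"
    by (intro bij_betw_byWitness[where f' = "extend_left_zero X Z"])
      (auto simp: facts has_neutral_restrict[OF Z(1) X])
  then show "card {F \<in> aqn_on X. left_zero_ideal X Z F \<and> has_neutral X F}
      = card {F \<in> aqn_on (X - Z). has_neutral (X - Z) F}"
    by (rule bij_betw_same_card)
qed

section \<open>Mirror images\<close>

lemma flip_aqn_on: "F \<in> aqn_on X \<Longrightarrow> flip X F \<in> aqn_on X"
  by (rule aqn_onI) (use aqn_onD[of F X] in \<open>auto simp: flip_def\<close>)

lemma flip_flip: "F \<in> aqn_on X \<Longrightarrow> flip X (flip X F) = F"
  using aqn_onD(5)[of F X]
  by (auto simp: flip_def fun_eq_iff restrict_def extensional_def)

lemma has_neutral_flip: "has_neutral X (flip X F) \<longleftrightarrow> has_neutral X F"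
  by (auto simp: has_neutral_def neutral_element_on_def flip_def)

lemma card_flip:
  assumes "\<And>F. F \<in> aqn_on X \<Longrightarrow> Q (flip X F) \<longleftrightarrow> P F"
  shows "card {F \<in> aqn_on X. Q F} = card {F \<in> aqn_on X. P F}"
proof -
  have "P (flip X F)" if "F \<in> aqn_on X" "Q F" for F
    using assms[OF flip_aqn_on[OF that(1)]] flip_flip[OF that(1)] that(2) by simp
  then have "bij_betw (flip X) {F \<in> aqn_on X. P F} {F \<in> aqn_on X. Q F}"
    by (intro bij_betw_byWitness[where f' = "flip X"])
      (auto simp: assms flip_aqn_on flip_flip)
  then show ?thesis by (simp add: bij_betw_same_card)
qed

section \<open>Case analysis on the products of the two ends\<close>

locale chain_ends =
  fixes X :: "'a::linorder set" and a b :: 'a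
  assumes finite_X: "finite X" and a: "a \<in> X" "\<And>x. x \<in> X \<Longrightarrow> a \<le> x"
    and b: "b \<in> X" "\<And>x. x \<in> X \<Longrightarrow> x \<le> b" and ab: "a \<noteq> b"
begin

lemma card_ge_2: "card X \<ge> 2"
  using card_mono[of X "{a, b}"] finite_X a b ab by simp

lemma ends_values:
  assumes "F \<in> aqn_on X"
  shows "F (a, b) = a \<or> F (a, b) = b" "F (b, a) = a \<or> F (b, a) = b"
    "F (a, a) = a" "F (b, b) = b"
  using aqn_onD(2)[OF assms] a b by auto

text \<open>Monotonicity gives \<open>F (a, x) \<le> F (a, b) = a\<close> and
  \<open>F (x, a) \<le> F (b, a) = a\<close>, and \<open>a\<close> is least.\<close>

lemma lower_iff:
  assumes F: "F \<in> aqn_on X"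
  shows "F (a, b) = a \<and> F (b, a) = a \<longleftrightarrow> left_zero_ideal X {a} F"
proof
  assume *: "F (a, b) = a \<and> F (b, a) = a"
  show "left_zero_ideal X {a} F"
    using * aqn_onD(1)[OF F] aqn_onD(4)[OF F, of a a _ b] aqn_onD(4)[OF F, of _ b a a] a b
    by (auto simp: left_zero_ideal_def intro!: antisym)
qed (use a b ab in \<open>auto simp: left_zero_ideal_def\<close>)

lemma upper_iff:
  assumes F: "F \<in> aqn_on X"
  shows "F (a, b) = b \<and> F (b, a) = b \<longleftrightarrow> left_zero_ideal X {b} F"
proof
  assume *: "F (a, b) = b \<and> F (b, a) = b"
  show "left_zero_ideal X {b} F"
    using * aqn_onD(1)[OF F] aqn_onD(4)[OF F, of b b a] aqn_onD(4)[OF F, of a _ b b] a b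
    by (auto simp: left_zero_ideal_def intro!: antisym)
qed (use a b ab in \<open>auto simp: left_zero_ideal_def\<close>)

definition proj1 :: "'a \<times> 'a \<Rightarrow> 'a" where
  "proj1 = restrict fst (X \<times> X)"

lemma proj1_aqn_on: "proj1 \<in> aqn_on X"
  by (rule aqn_onI) (auto simp: proj1_def)

text \<open>Monotonicity makes rows \<open>a\<close> and \<open>b\<close> constant. If every other
  row fixes both ends, \<open>{a, b}\<close> is a left zero ideal; a single other row that does not
  forces the same on all rows and yields the first projection.\<close>

lemma left_iff:
  assumes F: "F \<in> aqn_on X"
  shows "F (a, b) = a \<and> F (b, a) = b \<longleftrightarrow> left_zero_ideal X {a, b} F \<or> F = proj1"
proof
  assume *: "F (a, b) = a \<and> F (b, a) = b"
  note D = aqn_onD[OF F]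
  have row_a: "F (a, x) = a" if "x \<in> X" for x
    using * D(1)[of a x] D(4)[of a a x b] a b that by (auto intro: antisym)
  have row_b: "F (b, x) = b" if "x \<in> X" for x
    using * D(1)[of b x] D(4)[of b b a x] a b that by (auto intro: antisym)
  \<comment> \<open>Associativity at \<open>(x, a, b)\<close> and \<open>(x, b, a)\<close>: each row is either constant or fixes both ends.\<close>
  have row: "F (x, a) = x \<and> F (x, b) = x \<or> F (x, a) = a \<and> F (x, b) = b" if "x \<in> X" for x
    using D(2)[of x a] D(2)[of x b] D(3)[of x a b] D(3)[of x b a] * that a b by metis
  show "left_zero_ideal X {a, b} F \<or> F = proj1"
  proof (cases "\<exists>x\<in>X - {a, b}. F (x, a) = x")
    case False
    then have "left_zero_ideal X {a, b} F"
      using row_a row_b row by (fastforce simp: left_zero_ideal_def)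
    then show ?thesis by simp
  next
    case True
    then obtain x where x: "x \<in> X" "x \<noteq> a" "x \<noteq> b" "F (x, a) = x" by auto
    have x': "F (x, b) = x" using row[of x] x by metis
    \<comment> \<open>A row \<open>y\<close> fixing both ends cannot coexist with row
      \<open>x\<close>: comparing values at \<open>a\<close> if \<open>x \<le> y\<close> gives
      \<open>x = a\<close>, and at \<open>b\<close> if \<open>y < x\<close> gives
      \<open>x = b\<close>.\<close>
    have y: "F (y, a) = y \<and> F (y, b) = y" if "y \<in> X" for y
    proof (rule ccontr)
      assume "\<not> ?thesis"
      then have n: "F (y, a) = a" "F (y, b) = b" using row[OF that] by auto
      show False
      proof (cases "x \<le> y")
        case True
        then have "x \<le> a" using D(4)[of x y a a] x n that a by auto
        then show False using a(2)[of x] x by auto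
      next
        case False
        then have "b \<le> x" using D(4)[of y x b b] x x' n that b by auto
        then show False using b(2)[of x] x by auto
      qed
    qed
    have "F (y, z) = y" if "y \<in> X" "z \<in> X" for y z
      using y[OF that(1)] D(4)[of y y a z] D(4)[of y y z b] a b that by (auto intro: antisym)
    then have "F = proj1"
      using D(5) by (auto simp: proj1_def fun_eq_iff restrict_def extensional_def)
    then show ?thesis by simp
  qed
qed (use a b ab in \<open>auto simp: left_zero_ideal_def proj1_def\<close>)

text \<open>Quasitriviality leaves four cases for the two end products, disjoint since
  \<open>a \<noteq> b\<close>. \<open>P\<close> is later constantly true or
  \<open>has_neutral X\<close>.\<close>

lemma card_split:
  "card {F \<in> aqn_on X. P F} =
     card {F \<in> aqn_on X. (F (a, b) = a \<and> F (b, a) = a) \<and> P F} +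
     card {F \<in> aqn_on X. (F (a, b) = b \<and> F (b, a) = b) \<and> P F} +
     card {F \<in> aqn_on X. (F (a, b) = a \<and> F (b, a) = b) \<and> P F} +
     card {F \<in> aqn_on X. (F (a, b) = b \<and> F (b, a) = a) \<and> P F}"
  (is "_ = card ?A + card ?B + card ?C + card ?D")
proof -
  have fin: "finite {F \<in> aqn_on X. Q F}" for Q
    using finite_aqn_on[OF finite_X] by simp
  have "{F \<in> aqn_on X. P F} = ?A \<union> ?B \<union> ?C \<union> ?D"
    using ends_values by blast
  moreover have "card (?A \<union> ?B \<union> ?C \<union> ?D) = card ?A + card ?B + card ?C + card ?D"
    by (subst card_Un_disjoint; (use fin ab in auto)?)+
  ultimately show ?thesis by simp
qed

text \<open>\<open>flip X\<close> swaps \<open>F (a, b)\<close> and \<open>F (b, a)\<close>, hence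
  exchanges the two mixed cases.\<close>

lemma card_right:
  assumes "\<And>F. P (flip X F) \<longleftrightarrow> P F"
  shows "card {F \<in> aqn_on X. (F (a, b) = b \<and> F (b, a) = a) \<and> P F} =
    card {F \<in> aqn_on X. (F (a, b) = a \<and> F (b, a) = b) \<and> P F}"
  by (rule card_flip) (use assms a b in \<open>auto simp: flip_def\<close>)

text \<open>A neutral \<open>e\<close> would give \<open>e = a\<close> and
  \<open>e = b\<close>.\<close>

lemma not_has_neutral_proj1: "\<not> has_neutral X proj1"
  using a(1) b(1) ab unfolding has_neutral_def neutral_element_on_def proj1_def
  by (metis SigmaI fst_conv restrict_apply')

text \<open>For \<open>x\<close> outside the ideal, \<open>F (x, a)\<close> would have to be
  \<open>a\<close>, while \<open>proj1\<close> returns \<open>x\<close>.\<close>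

lemma left_zero_ideal_proj1_iff: "left_zero_ideal X {a, b} proj1 \<longleftrightarrow> X = {a, b}"
  using a b by (auto simp: left_zero_ideal_def proj1_def)

text \<open>For \<open>X = {a, b}\<close> the two left-zero subcases coincide; in the recurrence this makes \<open>A\<^sub>0 = 0\<close>,
  although the empty chain carries exactly one operation.\<close>
lemma card_aqn_on:
  "card (aqn_on X) = card (aqn_on (X - {a})) + card (aqn_on (X - {b})) +
     2 * (if X = {a, b} then 1 else card (aqn_on (X - {a, b})) + 1)"
proof -
  have Z: "card {F \<in> aqn_on X. left_zero_ideal X Z F} = card (aqn_on (X - Z))"
    if "Z \<subseteq> {a, b}" for Z
    by (rule card_left_zero_ideal) (use that a b card_ge_2 in auto)
  have "card {F \<in> aqn_on X. (F (a, b) = a \<and> F (b, a) = b) \<and> True} =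
      card ({F \<in> aqn_on X. left_zero_ideal X {a, b} F} \<union> {proj1})"
    using left_iff proj1_aqn_on by (intro arg_cong[where f = card]) auto
  also have "\<dots> = (if X = {a, b} then 1 else card (aqn_on (X - {a, b})) + 1)"
  proof (cases "X = {a, b}")
    case True
    have "F = proj1" if F: "F \<in> aqn_on X" "left_zero_ideal X {a, b} F" for F
    proof -
      have "F (x, y) = x" if "x \<in> X" "y \<in> X" for x y
        using F(2) that unfolding left_zero_ideal_def by (metis True)
      then show ?thesis
        using aqn_onD(5)[OF F(1)]
        by (auto simp: proj1_def fun_eq_iff restrict_def extensional_def)
    qed
    then have "{F \<in> aqn_on X. left_zero_ideal X {a, b} F} \<union> {proj1} = {proj1}" by auto
    then have "card ({F \<in> aqn_on X. left_zero_ideal X {a, b} F} \<union> {proj1}) = 1"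
      by (simp only:) simp
    then show ?thesis by (subst if_P[OF True])
  next
    case False
    \<comment> \<open>With a third element present, \<open>proj1\<close> lies outside the ideal case
      and adds exactly one.\<close>
    then show ?thesis
      using Z[of "{a, b}"] left_zero_ideal_proj1_iff finite_aqn_on[OF finite_X]
      by (subst card_Un_disjoint) auto
  qed
  finally have left: "card {F \<in> aqn_on X. (F (a, b) = a \<and> F (b, a) = b) \<and> True} = \<dots>" .
  show ?thesis
    using card_split[of "\<lambda>_. True"] card_right[of "\<lambda>_. True"] left Z[of "{a}"] Z[of "{b}"]
    by (simp add: lower_iff upper_iff cong: conj_cong)
qed

text \<open>\<open>proj1\<close> has no neutral element, so the constant term disappears. For
  \<open>X = {a, b}\<close> the last summand is zero because the empty set has no neutral element,
  which makes the formula uniform.\<close>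

lemma card_aqn_on_neutral:
  "card {F \<in> aqn_on X. has_neutral X F} =
     card {F \<in> aqn_on (X - {a}). has_neutral (X - {a}) F} +
     card {F \<in> aqn_on (X - {b}). has_neutral (X - {b}) F} +
     2 * card {F \<in> aqn_on (X - {a, b}). has_neutral (X - {a, b}) F}"
proof -
  have Z: "card {F \<in> aqn_on X. left_zero_ideal X Z F \<and> has_neutral X F}
      = card {F \<in> aqn_on (X - Z). has_neutral (X - Z) F}"
    if "Z \<subseteq> {a, b}" for Z
    by (rule card_left_zero_ideal) (use that a b card_ge_2 in auto)
  have "{F \<in> aqn_on X. (F (a, b) = a \<and> F (b, a) = b) \<and> has_neutral X F} =
      {F \<in> aqn_on X. left_zero_ideal X {a, b} F \<and> has_neutral X F}"
    using left_iff not_has_neutral_proj1 by auto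
  moreover have "{F \<in> aqn_on X. (F (a, b) = a \<and> F (b, a) = a) \<and> has_neutral X F} =
      {F \<in> aqn_on X. left_zero_ideal X {a} F \<and> has_neutral X F}"
    using lower_iff by auto
  moreover have "{F \<in> aqn_on X. (F (a, b) = b \<and> F (b, a) = b) \<and> has_neutral X F} =
      {F \<in> aqn_on X. left_zero_ideal X {b} F \<and> has_neutral X F}"
    using upper_iff by auto
  ultimately show ?thesis
    using card_split[of "has_neutral X"] card_right[of "has_neutral X"]
      Z[of "{a}"] Z[of "{b}"] Z[of "{a, b}"]
    by (simp add: has_neutral_flip)
qed

end

lemma aqn_on_singleton: "aqn_on {x} = {\<lambda>p\<in>{x} \<times> {x}. x}"
proof -
  have "F = (\<lambda>p\<in>{x} \<times> {x}. x)" if "F \<in> aqn_on {x}" for F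
    using aqn_onD(2,5)[OF that] by (auto simp: fun_eq_iff restrict_def extensional_def)
  moreover have "(\<lambda>p\<in>{x} \<times> {x}. x) \<in> aqn_on {x}"
    by (rule aqn_onI) auto
  ultimately show ?thesis by blast
qed

section \<open>Closed forms and their recurrences\<close>

definition count_all :: "nat \<Rightarrow> real" where
  "count_all n = 1 / 6 * ((2 + sqrt 3) * (1 + sqrt 3) ^ n + (2 - sqrt 3) * (1 - sqrt 3) ^ n - 4)"

definition count_neutral :: "nat \<Rightarrow> real" where
  "count_neutral n = 1 / (2 * sqrt 3) * ((1 + sqrt 3) ^ n - (1 - sqrt 3) ^ n)"

text \<open>\<open>1 + sqrt 3\<close> and \<open>1 - sqrt 3\<close> are the roots of
  \<open>x * x = 2 * x + 2\<close>, the characteristic equation of the homogeneous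
  recurrence.\<close>

lemma power_sqrt3_rec:
  "(1 + sqrt 3) ^ Suc (Suc n) = 2 * (1 + sqrt 3) ^ Suc n + 2 * (1 + sqrt 3) ^ n"
  "(1 - sqrt 3) ^ Suc (Suc n) = 2 * (1 - sqrt 3) ^ Suc n + 2 * (1 - sqrt 3) ^ n"
proof -
  have *: "x ^ Suc (Suc n) = 2 * x ^ Suc n + 2 * x ^ n" if "x * x = 2 * x + 2" for x :: real
  proof -
    have "x ^ Suc (Suc n) = (x * x) * x ^ n" by simp
    then show ?thesis unfolding that by (simp add: distrib_right)
  qed
  show "(1 + sqrt 3) ^ Suc (Suc n) = 2 * (1 + sqrt 3) ^ Suc n + 2 * (1 + sqrt 3) ^ n"
    by (rule *) (simp add: algebra_simps)
  show "(1 - sqrt 3) ^ Suc (Suc n) = 2 * (1 - sqrt 3) ^ Suc n + 2 * (1 - sqrt 3) ^ n"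
    by (rule *) (simp add: algebra_simps)
qed

text \<open>The summand \<open>-4\<close> contributes the constant \<open>-2/3\<close>, the solution
  of \<open>c = 2 * c + 2 * c + 2\<close>.\<close>

lemma count_all_simps:
  "count_all 0 = 0" "count_all (Suc 0) = 1"
  "count_all (Suc (Suc n)) = 2 * count_all (Suc n) + 2 * count_all n + 2"
proof -
  show "count_all (Suc (Suc n)) = 2 * count_all (Suc n) + 2 * count_all n + 2"
    unfolding count_all_def power_sqrt3_rec[of n] by algebra
qed (simp_all add: count_all_def algebra_simps)

lemma count_neutral_simps:
  "count_neutral 0 = 0" "count_neutral (Suc 0) = 1"
  "count_neutral (Suc (Suc n)) = 2 * count_neutral (Suc n) + 2 * count_neutral n"
proof -
  show "count_neutral (Suc (Suc n)) = 2 * count_neutral (Suc n) + 2 * count_neutral n"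
    unfolding count_neutral_def power_sqrt3_rec[of n] by algebra
qed (simp_all add: count_neutral_def)

section \<open>Induction on the size of the chain\<close>

lemma chain_ends_exist:
  assumes "card X \<ge> 2"
  obtains a b where "chain_ends X a b"
proof -
  have fin: "finite X" and ne: "X \<noteq> {}"
    using assms by (auto intro: card_ge_0_finite)
  have "Min X \<noteq> Max X"
  proof
    assume eq: "Min X = Max X"
    have "x = Min X" if "x \<in> X" for x
      using Min_le[OF fin that] Max_ge[OF fin that] eq by auto
    then have "X \<subseteq> {Min X}" by auto
    then have "card X \<le> 1" using card_mono[of "{Min X}" X] by simp
    then show False using assms by simp
  qed
  then have "chain_ends X (Min X) (Max X)"
    using fin ne by unfold_locales auto
  then show ?thesis by (rule that)
qed

text \<open>Strong induction by deleting ends. The empty chain is excluded: it carries one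
  operation, while \<open>count_all 0 = 0\<close>.\<close>

lemma card_aqn_on_eq:
  fixes X :: "'a::linorder set"
  assumes "card X \<ge> 1"
  shows "real (card (aqn_on X)) = count_all (card X)"
  using assms
proof (induction "card X" arbitrary: X rule: less_induct)
  case less
  show ?case
  proof (cases "card X = 1")
    case True
    then obtain x where "X = {x}" by (auto simp: card_1_singleton_iff)
    then show ?thesis by (simp add: aqn_on_singleton count_all_simps)
  next
    case False
    then have "card X \<ge> 2" using less.prems by simp
    then obtain a b where "chain_ends X a b" by (rule chain_ends_exist)
    then interpret chain_ends X a b .
    obtain n where n: "card X = Suc (Suc n)"
      using \<open>card X \<ge> 2\<close> by (metis add_2_eq_Suc le_Suc_ex)
    have cards: "card (X - {a}) = Suc n" "card (X - {b}) = Suc n" "card (X - {a, b}) = n"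
      using n a b ab finite_X by (auto simp: card_Diff_subset)
    \<comment> \<open>For \<open>n = 0\<close> the special branch yields \<open>1\<close>, matching
      \<open>count_all 0 = 0\<close>; otherwise \<open>X - {a, b}\<close> is nonempty and the
      induction hypothesis applies.\<close>
    have "real (if X = {a, b} then 1 else card (aqn_on (X - {a, b})) + 1) = count_all n + 1"
    proof (cases "X = {a, b}")
      case True
      then have "n = 0" using cards(3) by simp
      then show ?thesis using True by (simp add: count_all_simps)
    next
      case False
      then have "X - {a, b} \<noteq> {}" using a b by auto
      then have "n \<ge> 1" using cards(3) finite_X
        by (metis One_nat_def Suc_leI card_gt_0_iff finite_Diff)
      then show ?thesis using False less.hyps[of "X - {a, b}"] n cards by simp
    qed
    moreover have "real (card (aqn_on (X - {a}))) = count_all (Suc n)"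
      "real (card (aqn_on (X - {b}))) = count_all (Suc n)"
      using less.hyps[of "X - {a}"] less.hyps[of "X - {b}"] n cards by simp_all
    ultimately show ?thesis
      unfolding card_aqn_on n count_all_simps(3) of_nat_add of_nat_mult by simp
  qed
qed

text \<open>The empty chain is a base case here: it has no neutral element, in agreement with
  \<open>count_neutral 0 = 0\<close>.\<close>

lemma card_aqn_on_neutral_eq:
  fixes X :: "'a::linorder set"
  assumes "finite X"
  shows "real (card {F \<in> aqn_on X. has_neutral X F}) = count_neutral (card X)"
  using assms
proof (induction "card X" arbitrary: X rule: less_induct)
  case less
  consider "card X = 0" | "card X = 1" | "card X \<ge> 2" by linarith
  then show ?case
  proof cases
    case 1
    then have "X = {}" using less.prems by simp
    then show ?thesis
      by (simp add: has_neutral_def neutral_element_on_def count_neutral_simps)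
  next
    case 2
    then obtain x where x: "X = {x}" by (auto simp: card_1_singleton_iff)
    then have "{F \<in> aqn_on X. has_neutral X F} = {\<lambda>p\<in>{x} \<times> {x}. x}"
      by (auto simp: aqn_on_singleton has_neutral_def neutral_element_on_def)
    then show ?thesis by (simp add: x count_neutral_simps)
  next
    case 3
    then obtain a b where "chain_ends X a b" by (rule chain_ends_exist)
    then interpret chain_ends X a b .
    obtain n where n: "card X = Suc (Suc n)"
      using 3 by (metis add_2_eq_Suc le_Suc_ex)
    have cards: "card (X - {a}) = Suc n" "card (X - {b}) = Suc n" "card (X - {a, b}) = n"
      using n a b ab finite_X by (auto simp: card_Diff_subset)
    show ?thesis
      unfolding card_aqn_on_neutral n count_neutral_simps(3) of_nat_add of_nat_mult
      using less.hyps[of "X - {a}"] less.hyps[of "X - {b}"] less.hyps[of "X - {a, b}"]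
        n cards finite_X by simp
  qed
qed

theorem theorem6p1:
  fixes k :: nat
  assumes "k \<ge> 1"
  shows "real (A_num k) =
           1 / 6 * ((2 + sqrt 3) * (1 + sqrt 3) ^ k + (2 - sqrt 3) * (1 - sqrt 3) ^ k - 4) \<and>
         real (B_num k) =
           1 / (2 * sqrt 3) * ((1 + sqrt 3) ^ k - (1 - sqrt 3) ^ k)"
proof -
  have ops: "aqn_operations k = aqn_on (chain k)"
    by (simp add: aqn_operations_def aqn_on_def)
  have chain: "card (chain k) = k" "finite (chain k)"
    by (simp_all add: chain_def)
  show ?thesis
    using card_aqn_on_eq[of "chain k"] card_aqn_on_neutral_eq[of "chain k"] assms
    by (simp add: A_num_def B_num_def ops chain count_all_def count_neutral_def
        flip: has_neutral_def)
qed

end
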